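(* Let $A \in \mathbb{R}^{m\times n}$ have rank $r$, let $1 \le k \le r-1$, let $\lambda > 0$ and $b \in \mathbb{R}^m$. Let $A_k = U_k \Sigma_k V_k^T$ be the rank-$k$ truncated singular value decomposition of $A$ and $\hat{A}_k = A - A_k$. Define $$\tilde{x}_1 = (A_k^T A_k + \lambda I)^{-1} A_k^T b, \qquad \hat{x}_1 = (A_k^T A_k + \lambda I)^{-1} A^T b, \qquad \tilde{x}_3 = V_k (\Sigma_k^2 + \lambda I)^{-1} \Sigma_k U_k^T b.$$ Then $$\tilde{x}_3 = \tilde{x}_1$$ and $$\hat{x}_1 - \tilde{x}_1 = \lambda^{-1}(A^T - A_k^T) b = \lambda^{-1} \hat{A}_k^T b.$$
   Context: Write the singular value decomposition of $A \in \mathbb{R}^{m \times n}$ of rank $r$ as $A = \sum_{j=1}^{r} \sigma_j u_j v_j^T$ with $\sigma_1 \ge \sigma_2 \ge \dots \ge \sigma_r > 0$, where $u_1,\dots,u_r \in \mathbb{R}^m$ are orthonormal and $v_1,\dots,v_r \in \mathbb{R}^n$ are orthonormal. For $1 \le k \le r-1$, set $U_k = [u_1 \cdots u_k]$, $V_k = [v_1 \cdots v_k]$, $\Sigma_k = \mathrm{Diag}(\sigma_1,\dots,\sigma_k)$, $A_k = U_k \Sigma_k V_k^T$ (the truncated SVD), and $\hat{A}_k = \sum_{j=k+1}^r \sigma_j u_j v_j^T = A - A_k$. $I$ denotes the identity matrix of the appropriate size. *)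

theory Defs
  imports "Jordan_Normal_Form.DL_Rank" "Jordan_Normal_Form.Gauss_Jordan_Elimination"
begin

(* The sum of the rank-one matrices sigma_l u_l v_l^T over l in J, written entrywise because
   matrices with run-time dimensions form no additive type class.  List positions start at 0. *)
definition rank_one_sum ::
  "nat \<Rightarrow> nat \<Rightarrow> real list \<Rightarrow> real vec list \<Rightarrow> real vec list \<Rightarrow> nat set \<Rightarrow> real mat" where
  "rank_one_sum m n \<sigma> us vs J =
     mat m n (\<lambda>(i, j). \<Sum>l\<in>J. \<sigma> ! l * (us ! l) $ i * (vs ! l) $ j)"

definition orthonormal_list :: "nat \<Rightarrow> real vec list \<Rightarrow> bool" where
  "orthonormal_list d ws \<longleftrightarrow>
     set ws \<subseteq> carrier_vec d \<and>
     (\<forall>i<length ws. \<forall>j<length ws. ws ! i \<bullet> ws ! j = (if i = j then 1 else 0))"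

definition is_svd ::
  "nat \<Rightarrow> nat \<Rightarrow> nat \<Rightarrow> real mat \<Rightarrow> real list \<Rightarrow> real vec list \<Rightarrow> real vec list \<Rightarrow> bool" where
  "is_svd m n r A \<sigma> us vs \<longleftrightarrow>
     length \<sigma> = r \<and> length us = r \<and> length vs = r \<and>
     (\<forall>i j. i \<le> j \<and> j < r \<longrightarrow> \<sigma> ! j \<le> \<sigma> ! i) \<and> (\<forall>i<r. 0 < \<sigma> ! i) \<and>
     orthonormal_list m us \<and> orthonormal_list n vs \<and>
     A = rank_one_sum m n \<sigma> us vs {..<r}"

definition first_cols :: "nat \<Rightarrow> nat \<Rightarrow> real vec list \<Rightarrow> real mat" where
  "first_cols d k ws = mat_of_cols d (take k ws)"

definition first_diag :: "nat \<Rightarrow> real list \<Rightarrow> real mat" where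
  "first_diag k \<sigma> = mat_diag k (\<lambda>i. \<sigma> ! i)"

definition truncated_svd ::
  "nat \<Rightarrow> nat \<Rightarrow> nat \<Rightarrow> real list \<Rightarrow> real vec list \<Rightarrow> real vec list \<Rightarrow> real mat" where
  "truncated_svd m n k \<sigma> us vs =
     first_cols m k us * first_diag k \<sigma> * (first_cols n k vs)\<^sup>T"

(* The library's mat_inverse returns None on singular matrices.  By the lemmas below,
   the value is the actual inverse on every matrix of the form B^T B + lambda I with lambda > 0. *)
definition mat_inv :: "real mat \<Rightarrow> real mat" where
  "mat_inv M = the (mat_inverse M)"

lemma mat_inv_correct:
  assumes M: "M \<in> carrier_mat n n" and det: "det M \<noteq> 0"
  shows "M * mat_inv M = 1\<^sub>m n" "mat_inv M * M = 1\<^sub>m n" "mat_inv M \<in> carrier_mat n n"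
proof -
  have "M \<in> Units (ring_mat TYPE(real) n ())"
    using det_non_zero_imp_unit[OF M det] .
  then obtain B where "mat_inverse M = Some B"
    using mat_inverse(1)[OF M, of "()"] by (cases "mat_inverse M") auto
  then show "M * mat_inv M = 1\<^sub>m n" "mat_inv M * M = 1\<^sub>m n" "mat_inv M \<in> carrier_mat n n"
    using mat_inverse(2)[OF M] by (auto simp: mat_inv_def)
qed

lemma det_regularized_gram:
  assumes B: "B \<in> carrier_mat p n" and pos: "(lam::real) > 0"
  shows "det (B\<^sup>T * B + lam \<cdot>\<^sub>m 1\<^sub>m n) \<noteq> 0"
proof
  let ?M = "B\<^sup>T * B + lam \<cdot>\<^sub>m 1\<^sub>m n"
  assume "det ?M = 0"
  then obtain v where v: "v \<in> carrier_vec n" "v \<noteq> 0\<^sub>v n" "?M *\<^sub>v v = 0\<^sub>v n"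
    using det_0_iff_vec_prod_zero[of ?M n] B by auto
  have BTB: "(B\<^sup>T * B) \<in> carrier_mat n n" using B by simp
  have "?M *\<^sub>v v = B\<^sup>T * B *\<^sub>v v + (lam \<cdot>\<^sub>m 1\<^sub>m n) *\<^sub>v v"
    by (rule add_mult_distrib_mat_vec[OF BTB _ v(1)]) simp
  also have "B\<^sup>T * B *\<^sub>v v = B\<^sup>T *\<^sub>v (B *\<^sub>v v)"
    by (rule assoc_mult_mat_vec[of _ n p]) (use B v in auto)
  also have "(lam \<cdot>\<^sub>m 1\<^sub>m n) *\<^sub>v v = lam \<cdot>\<^sub>v v"
    using v(1) by (auto simp: scalar_prod_def if_distrib if_distribR sum.delta cong: if_cong)
  finally have "v \<bullet> (?M *\<^sub>v v) = v \<bullet> (B\<^sup>T *\<^sub>v (B *\<^sub>v v)) + lam * (v \<bullet> v)"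
    using v(1) B by (simp add: scalar_prod_add_distrib[of _ n])
  also have "v \<bullet> (B\<^sup>T *\<^sub>v (B *\<^sub>v v)) = (B *\<^sub>v v) \<bullet> (B *\<^sub>v v)"
    using transpose_vec_mult_scalar[OF B v(1), of "B *\<^sub>v v"] B v(1)
    by (metis comm_scalar_prod mult_mat_vec_carrier transpose_carrier_mat)
  finally have "(B *\<^sub>v v) \<bullet> (B *\<^sub>v v) + lam * (v \<bullet> v) = 0" using v by simp
  moreover have "(B *\<^sub>v v) \<bullet> (B *\<^sub>v v) \<ge> 0" "v \<bullet> v \<ge> 0"
    by (auto simp: scalar_prod_def intro: sum_nonneg)
  ultimately have "v \<bullet> v = 0" using pos
    by (smt (verit) mult_pos_pos)
  then have "\<forall>i<n. v $ i = 0" using v(1) by (auto simp: scalar_prod_def sum_nonneg_eq_0_iff)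
  then show False using v by auto
qed

lemma residual_eq_tail_sum:
  assumes svd: "is_svd m n r A \<sigma> us vs" and k: "k \<le> r"
  shows "A - truncated_svd m n k \<sigma> us vs = rank_one_sum m n \<sigma> us vs {k..<r}"
proof (rule eq_matI)
  have len: "length us = r" "length vs = r" using svd by (auto simp: is_svd_def)
  show dims: "dim_row (A - truncated_svd m n k \<sigma> us vs) = dim_row (rank_one_sum m n \<sigma> us vs {k..<r})"
    "dim_col (A - truncated_svd m n k \<sigma> us vs) = dim_col (rank_one_sum m n \<sigma> us vs {k..<r})"
    by (auto simp: truncated_svd_def first_cols_def rank_one_sum_def)
  fix i j assume "i < dim_row (rank_one_sum m n \<sigma> us vs {k..<r})"
    "j < dim_col (rank_one_sum m n \<sigma> us vs {k..<r})"
  then have ij: "i < m" "j < n" by (auto simp: rank_one_sum_def)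
  have U: "first_cols m k us \<in> carrier_mat m k" using len k by (auto simp: first_cols_def)
  have T: "truncated_svd m n k \<sigma> us vs $$ (i, j) = (\<Sum>l<k. \<sigma> ! l * us ! l $ i * vs ! l $ j)"
    unfolding truncated_svd_def first_diag_def mat_diag_mult_right[OF U]
    using ij len k
    by (auto simp: first_cols_def scalar_prod_def mat_of_cols_index atLeast0LessThan intro!: sum.cong)
  have "(\<Sum>l<r. \<sigma> ! l * us ! l $ i * vs ! l $ j)
     = (\<Sum>l<k. \<sigma> ! l * us ! l $ i * vs ! l $ j) + (\<Sum>l\<in>{k..<r}. \<sigma> ! l * us ! l $ i * vs ! l $ j)"
    unfolding lessThan_atLeast0 by (rule sum.atLeastLessThan_concat[symmetric]) (use k in auto)
  moreover have "A = rank_one_sum m n \<sigma> us vs {..<r}" using svd by (simp add: is_svd_def)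
  moreover have "i < dim_row (truncated_svd m n k \<sigma> us vs)" "j < dim_col (truncated_svd m n k \<sigma> us vs)"
    using ij by (auto simp: truncated_svd_def first_cols_def)
  ultimately show "(A - truncated_svd m n k \<sigma> us vs) $$ (i, j) = rank_one_sum m n \<sigma> us vs {k..<r} $$ (i, j)"
    using ij T by (simp add: rank_one_sum_def del: index_mult_mat)
qed

end

theory Submission
  imports Defs
begin

text \<open>
  Write \<open>U\<close>, \<open>S\<close>, \<open>V\<close> for the three truncated factors, so that the truncated matrix is
  \<open>B = U S V\<^sup>T\<close>, and let \<open>M = B\<^sup>T B + \<lambda> I\<close> be the regularised Gram matrix.  It is invertible
  because \<open>\<lambda> > 0\<close>, so both identities are proved by checking that a candidate vector solves
  a linear system with matrix \<open>M\<close>.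

  Two facts about the action of \<open>M\<close> carry the proof.  On the range of \<open>V\<close> it acts as
  the diagonal matrix does: orthonormality gives \<open>B\<^sup>T B = V S\<^sup>2 V\<^sup>T\<close>, hence
  \<open>M V = V (S\<^sup>2 + \<lambda> I)\<close> (lemma \<open>regularized_gram_intertwines\<close>).  Applying this to
  \<open>(S\<^sup>2 + \<lambda> I)\<^sup>-\<^sup>1 S U\<^sup>T b\<close> yields \<open>V S U\<^sup>T b = B\<^sup>T b\<close>, which is the system solved by \<open>x1_tilde\<close>.
  On the kernel of \<open>B\<close> it acts as multiplication by \<open>\<lambda>\<close>.  The residual \<open>A - B\<close> only involves
  right singular vectors orthogonal to the columns of \<open>V\<close>
  (lemma \<open>rank_one_sum_annihilates_first_cols\<close>), so \<open>(A - B)\<^sup>T b\<close> lies in this kernel and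
  \<open>M\<^sup>-\<^sup>1 (A - B)\<^sup>T b = \<lambda>\<^sup>-\<^sup>1 (A - B)\<^sup>T b\<close>.  The left side is the difference of the two
  regularised solutions.
\<close>

lemma mat_inv_mult_eqI:
  assumes M: "M \<in> carrier_mat n n" and det: "det M \<noteq> 0"
    and y: "y \<in> carrier_vec n" and eq: "M *\<^sub>v y = w"
  shows "mat_inv M *\<^sub>v w = y"
proof -
  have "mat_inv M *\<^sub>v w = (mat_inv M * M) *\<^sub>v y"
    unfolding eq[symmetric]
    by (rule assoc_mult_mat_vec[symmetric, OF mat_inv_correct(3)[OF M det] M y])
  then show ?thesis using mat_inv_correct(2)[OF M det] y by simp
qed

lemma scalar_mat_mult_vec:
  assumes "v \<in> carrier_vec n"
  shows "((c :: 'a :: comm_ring_1) \<cdot>\<^sub>m 1\<^sub>m n) *\<^sub>v v = c \<cdot>\<^sub>v v"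
  using assms
  by (auto simp: scalar_prod_def if_distrib if_distribR sum.delta cong: if_cong)

lemma first_cols_carrier:
  "k \<le> length ws \<Longrightarrow> first_cols d k ws \<in> carrier_mat d k"
  by (auto simp: first_cols_def)

lemma col_first_cols:
  assumes "set ws \<subseteq> carrier_vec d" "k \<le> length ws" "j < k"
  shows "col (first_cols d k ws) j = ws ! j"
proof -
  have "ws ! j \<in> carrier_vec d" using assms by (meson less_le_trans nth_mem subsetD)
  then show ?thesis
    using assms unfolding first_cols_def by (subst col_mat_of_cols) auto
qed

lemma first_cols_isometry:
  assumes "orthonormal_list d ws" "k \<le> length ws"
  shows "(first_cols d k ws)\<^sup>T * first_cols d k ws = 1\<^sub>m k"
  using assms first_cols_carrier[OF assms(2), of d]
  by (intro eq_matI) (auto simp: orthonormal_list_def col_first_cols)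

text \<open>
  Entry \<open>(i, j)\<close> of the product is the sum over \<open>l \<in> J\<close> of \<open>\<sigma>\<^sub>l (u\<^sub>l)\<^sub>i\<close> times the inner product
  of \<open>v\<^sub>l\<close> and \<open>v\<^sub>j\<close>; since \<open>j < k \<le> l\<close>, every inner product vanishes.
\<close>

lemma rank_one_sum_annihilates_first_cols:
  assumes on: "orthonormal_list n vs" and k: "k \<le> length vs" and J: "J \<subseteq> {k..<length vs}"
  shows "rank_one_sum m n \<sigma> us vs J * first_cols n k vs = 0\<^sub>m m k"
proof (rule eq_matI)
  fix i j assume "i < dim_row (0\<^sub>m m k)" "j < dim_col (0\<^sub>m m k)"
  then have i: "i < m" and j: "j < k" by auto
  have sub: "set vs \<subseteq> carrier_vec n" using on by (simp add: orthonormal_list_def)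
  have vj: "vs ! j \<in> carrier_vec n" using sub j k by (meson less_le_trans nth_mem subsetD)
  have "(rank_one_sum m n \<sigma> us vs J * first_cols n k vs) $$ (i, j)
      = row (rank_one_sum m n \<sigma> us vs J) i \<bullet> vs ! j"
    using i j first_cols_carrier[OF k, of n]
    by (simp add: col_first_cols[OF sub k j] rank_one_sum_def)
  also have "\<dots> = (\<Sum>c<n. \<Sum>l\<in>J. \<sigma> ! l * us ! l $ i * (vs ! l $ c * vs ! j $ c))"
    using i vj
    by (simp add: scalar_prod_def rank_one_sum_def atLeast0LessThan sum_distrib_right mult.assoc)
  also have "\<dots> = (\<Sum>l\<in>J. \<sigma> ! l * us ! l $ i * (vs ! l \<bullet> vs ! j))"
    using vj
    by (subst sum.swap) (simp add: scalar_prod_def atLeast0LessThan sum_distrib_left)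
  also have "\<dots> = 0"
  proof (rule sum.neutral, rule ballI)
    fix l assume "l \<in> J"
    then have "l < length vs" "l \<noteq> j" "j < length vs" using J j k by auto
    then have "vs ! l \<bullet> vs ! j = 0" using on by (simp add: orthonormal_list_def)
    then show "\<sigma> ! l * us ! l $ i * (vs ! l \<bullet> vs ! j) = 0" by simp
  qed
  finally show "(rank_one_sum m n \<sigma> us vs J * first_cols n k vs) $$ (i, j) = 0\<^sub>m m k $$ (i, j)"
    using i j by simp
qed (use first_cols_carrier[OF k, of n] in \<open>auto simp: rank_one_sum_def\<close>)

lemma transpose_factorization:
  fixes U S V :: "'a :: comm_ring_1 mat"
  assumes U: "U \<in> carrier_mat m k" and S: "S \<in> carrier_mat k k" and V: "V \<in> carrier_mat n k"
    and sym: "S\<^sup>T = S"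
  shows "(U * S * V\<^sup>T)\<^sup>T = V * (S * U\<^sup>T)"
proof -
  have "U * S \<in> carrier_mat m k" "V\<^sup>T \<in> carrier_mat k n" using U S V by auto
  from transpose_mult[OF this] show ?thesis using transpose_mult[OF U S] sym by simp
qed

text \<open>
  The columns of \<open>V\<close> span an invariant subspace of the regularised Gram matrix, and in the
  coordinates given by \<open>V\<close> its restriction there is \<open>S\<^sup>2 + \<lambda> I\<close>: the inner factor \<open>U\<^sup>T U\<close> and the
  factor \<open>V\<^sup>T V\<close> created on the right both collapse to the identity.
\<close>

lemma regularized_gram_intertwines:
  fixes lam :: "'a :: comm_ring_1"
  assumes U: "U \<in> carrier_mat m k" and S: "S \<in> carrier_mat k k" and V: "V \<in> carrier_mat n k"
    and UU: "U\<^sup>T * U = 1\<^sub>m k" and VV: "V\<^sup>T * V = 1\<^sub>m k" and sym: "S\<^sup>T = S"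
    and B: "B = U * S * V\<^sup>T"
  shows "(B\<^sup>T * B + lam \<cdot>\<^sub>m 1\<^sub>m n) * V = V * (S * S + lam \<cdot>\<^sub>m 1\<^sub>m k)"
proof -
  have US: "U * S \<in> carrier_mat m k" using U S by simp
  have Bc: "B \<in> carrier_mat m n" using B U S V by simp
  have "B * V = U * S * (V\<^sup>T * V)"
    unfolding B by (rule assoc_mult_mat[OF US _ V]) (use V in simp)
  then have BV: "B * V = U * S" using right_mult_one_mat[OF US] VV by simp
  have BT: "B\<^sup>T = V * (S * U\<^sup>T)"
    unfolding B by (rule transpose_factorization[OF U S V sym])
  have "B\<^sup>T * B * V = B\<^sup>T * (U * S)"
    unfolding BV[symmetric] by (rule assoc_mult_mat[of _ n m _ n _ k]) (use Bc V in auto)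
  also have "\<dots> = V * ((S * U\<^sup>T) * (U * S))"
    unfolding BT by (rule assoc_mult_mat[of _ n k _ m _ k]) (use U S V in auto)
  also have "(S * U\<^sup>T) * (U * S) = S * (U\<^sup>T * (U * S))"
    by (rule assoc_mult_mat[of _ k k _ m _ k]) (use U S in auto)
  also have "U\<^sup>T * (U * S) = (U\<^sup>T * U) * S"
    by (rule assoc_mult_mat[symmetric, of _ k m _ k _ k]) (use U S in auto)
  also have "\<dots> = S" using UU S by simp
  finally have gram: "B\<^sup>T * B * V = V * (S * S)" .
  have "(B\<^sup>T * B + lam \<cdot>\<^sub>m 1\<^sub>m n) * V = B\<^sup>T * B * V + (lam \<cdot>\<^sub>m 1\<^sub>m n) * V"
    by (rule add_mult_distrib_mat[of _ n n _ _ k]) (use Bc V in auto)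
  also have "(lam \<cdot>\<^sub>m 1\<^sub>m n) * V = lam \<cdot>\<^sub>m V"
    using V mult_smult_assoc_mat[of "1\<^sub>m n" n n V k lam] by simp
  also have "lam \<cdot>\<^sub>m V = V * (lam \<cdot>\<^sub>m 1\<^sub>m k)"
    using V mult_smult_distrib[of V n k "1\<^sub>m k" k lam] by simp
  also have "B\<^sup>T * B * V + V * (lam \<cdot>\<^sub>m 1\<^sub>m k) = V * (S * S + lam \<cdot>\<^sub>m 1\<^sub>m k)"
    unfolding gram by (rule mult_add_distrib_mat[symmetric, of _ n k _ k]) (use S V in auto)
  finally show ?thesis .
qed

text \<open>
  The regularised pseudoinverse may be applied in the small \<open>k\<close>-dimensional coordinates: by the
  intertwining relation, the vector computed there solves the regularised normal equations.
\<close>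

lemma regularized_solution_factored:
  assumes U: "U \<in> carrier_mat m k" and S: "S \<in> carrier_mat k k" and V: "V \<in> carrier_mat n k"
    and UU: "U\<^sup>T * U = 1\<^sub>m k" and VV: "V\<^sup>T * V = 1\<^sub>m k" and sym: "S\<^sup>T = S"
    and B: "B = U * S * V\<^sup>T" and lam: "lam > 0" and b: "b \<in> carrier_vec m"
  shows "mat_inv (B\<^sup>T * B + lam \<cdot>\<^sub>m 1\<^sub>m n) *\<^sub>v (B\<^sup>T *\<^sub>v b)
       = V *\<^sub>v (mat_inv (S * S + lam \<cdot>\<^sub>m 1\<^sub>m k) *\<^sub>v (S *\<^sub>v (U\<^sup>T *\<^sub>v b)))"
proof -
  let ?M = "B\<^sup>T * B + lam \<cdot>\<^sub>m 1\<^sub>m n" and ?D = "S * S + lam \<cdot>\<^sub>m 1\<^sub>m k"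
  define c where "c = S *\<^sub>v (U\<^sup>T *\<^sub>v b)"
  have Bc: "B \<in> carrier_mat m n" using B U S V by simp
  have M: "?M \<in> carrier_mat n n" and D: "?D \<in> carrier_mat k k" using Bc S by auto
  have c: "c \<in> carrier_vec k" using S U b by (auto simp: c_def)
  \<comment> \<open>Symmetry makes \<open>S * S\<close> a Gram matrix, so the small system is invertible by the same
     argument as the large one.\<close>
  have detD: "det ?D \<noteq> 0" using det_regularized_gram[OF S lam] sym by simp
  note Dinv = mat_inv_correct[OF D detD]
  have z: "mat_inv ?D *\<^sub>v c \<in> carrier_vec k" using Dinv(3) c by simp
  have "?M *\<^sub>v (V *\<^sub>v (mat_inv ?D *\<^sub>v c)) = (?M * V) *\<^sub>v (mat_inv ?D *\<^sub>v c)"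
    by (rule assoc_mult_mat_vec[symmetric, OF M V z])
  also have "?M * V = V * ?D"
    by (rule regularized_gram_intertwines[OF U S V UU VV sym B])
  also have "(V * ?D) *\<^sub>v (mat_inv ?D *\<^sub>v c) = V *\<^sub>v (?D *\<^sub>v (mat_inv ?D *\<^sub>v c))"
    by (rule assoc_mult_mat_vec[OF V D z])
  also have "?D *\<^sub>v (mat_inv ?D *\<^sub>v c) = (?D * mat_inv ?D) *\<^sub>v c"
    by (rule assoc_mult_mat_vec[symmetric, OF D Dinv(3) c])
  also have "\<dots> = c" using Dinv(1) c by simp
  also have "V *\<^sub>v c = B\<^sup>T *\<^sub>v b"
  proof -
    have BT: "B\<^sup>T = V * (S * U\<^sup>T)"
      unfolding B by (rule transpose_factorization[OF U S V sym])
    have "B\<^sup>T *\<^sub>v b = V *\<^sub>v ((S * U\<^sup>T) *\<^sub>v b)"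
      unfolding BT by (rule assoc_mult_mat_vec[of _ n k _ m]) (use U S V b in auto)
    also have "(S * U\<^sup>T) *\<^sub>v b = c"
      unfolding c_def by (rule assoc_mult_mat_vec[of _ k k _ m]) (use U S b in auto)
    finally show ?thesis by simp
  qed
  finally have "?M *\<^sub>v (V *\<^sub>v (mat_inv ?D *\<^sub>v c)) = B\<^sup>T *\<^sub>v b" .
  then have "mat_inv ?M *\<^sub>v (B\<^sup>T *\<^sub>v b) = V *\<^sub>v (mat_inv ?D *\<^sub>v c)"
    by (intro mat_inv_mult_eqI[OF M det_regularized_gram[OF Bc lam]]) (use V z in auto)
  then show ?thesis by (simp add: c_def)
qed

text \<open>On the kernel of \<open>B\<close> the regularised Gram matrix reduces to its scalar part.\<close>

lemma regularized_gram_inv_on_kernel: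
  assumes B: "B \<in> carrier_mat m n" and lam: "lam > 0"
    and w: "w \<in> carrier_vec n" and ker: "B *\<^sub>v w = 0\<^sub>v m"
  shows "mat_inv (B\<^sup>T * B + lam \<cdot>\<^sub>m 1\<^sub>m n) *\<^sub>v w = inverse lam \<cdot>\<^sub>v w"
proof (rule mat_inv_mult_eqI[OF _ det_regularized_gram[OF B lam]])
  let ?y = "inverse lam \<cdot>\<^sub>v w"
  have y: "?y \<in> carrier_vec n" using w by simp
  have "B *\<^sub>v ?y = 0\<^sub>v m" using mult_mat_vec[OF B w] ker by auto
  moreover have "(B\<^sup>T * B) *\<^sub>v ?y = B\<^sup>T *\<^sub>v (B *\<^sub>v ?y)"
    by (rule assoc_mult_mat_vec[of _ n m]) (use B y in auto)
  ultimately have "(B\<^sup>T * B) *\<^sub>v ?y = 0\<^sub>v n" using B by auto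
  moreover have "(B\<^sup>T * B + lam \<cdot>\<^sub>m 1\<^sub>m n) *\<^sub>v ?y
      = (B\<^sup>T * B) *\<^sub>v ?y + (lam \<cdot>\<^sub>m 1\<^sub>m n) *\<^sub>v ?y"
    by (rule add_mult_distrib_mat_vec[of _ n n]) (use B y in auto)
  ultimately show "(B\<^sup>T * B + lam \<cdot>\<^sub>m 1\<^sub>m n) *\<^sub>v ?y = w"
    using lam w by (simp add: scalar_mat_mult_vec[OF y] smult_smult_assoc)
qed (use B w in auto)

theorem lemma5p5:
  fixes m n r k :: nat
    and A A\<^sub>k A_hat U\<^sub>k \<Sigma>\<^sub>k V\<^sub>k :: "real mat"
    and \<sigma> :: "real list" and us vs :: "real vec list"
    and lam :: real
    and b x1_tilde x1_hat x3_tilde :: "real vec"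
  assumes "A \<in> carrier_mat m n"
    and "vec_space.rank m A = r"
    and "is_svd m n r A \<sigma> us vs"
    and "1 \<le> k" and "k \<le> r - 1"
    and "lam > 0"
    and "b \<in> carrier_vec m"
    and "U\<^sub>k = first_cols m k us"
    and "V\<^sub>k = first_cols n k vs"
    and "\<Sigma>\<^sub>k = first_diag k \<sigma>"
    and "A\<^sub>k = truncated_svd m n k \<sigma> us vs"
    and "A_hat = A - A\<^sub>k"
    and "x1_tilde = mat_inv (A\<^sub>k\<^sup>T * A\<^sub>k + lam \<cdot>\<^sub>m 1\<^sub>m n) *\<^sub>v (A\<^sub>k\<^sup>T *\<^sub>v b)"
    and "x1_hat = mat_inv (A\<^sub>k\<^sup>T * A\<^sub>k + lam \<cdot>\<^sub>m 1\<^sub>m n) *\<^sub>v (A\<^sup>T *\<^sub>v b)"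
    and "x3_tilde = V\<^sub>k *\<^sub>v (mat_inv (\<Sigma>\<^sub>k ^\<^sub>m 2 + lam \<cdot>\<^sub>m 1\<^sub>m k) *\<^sub>v (\<Sigma>\<^sub>k *\<^sub>v (U\<^sub>k\<^sup>T *\<^sub>v b)))"
  shows "x3_tilde = x1_tilde
    \<and> x1_hat - x1_tilde = inverse lam \<cdot>\<^sub>v ((A\<^sup>T - A\<^sub>k\<^sup>T) *\<^sub>v b)
    \<and> inverse lam \<cdot>\<^sub>v ((A\<^sup>T - A\<^sub>k\<^sup>T) *\<^sub>v b) = inverse lam \<cdot>\<^sub>v (A_hat\<^sup>T *\<^sub>v b)"
proof -
  note svd = assms(3) and lam = assms(6) and b = assms(7)
    and defs = assms(8-12)
  have kr: "k \<le> r" using assms(5) by simp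
  have len: "length us = r" "length vs = r" and onU: "orthonormal_list m us"
    and onV: "orthonormal_list n vs"
    using svd by (auto simp: is_svd_def)
  have A: "A \<in> carrier_mat m n" by fact
  have U: "U\<^sub>k \<in> carrier_mat m k" and V: "V\<^sub>k \<in> carrier_mat n k" and S: "\<Sigma>\<^sub>k \<in> carrier_mat k k"
    using kr len by (auto simp: defs first_cols_carrier first_diag_def)
  have UU: "U\<^sub>k\<^sup>T * U\<^sub>k = 1\<^sub>m k" and VV: "V\<^sub>k\<^sup>T * V\<^sub>k = 1\<^sub>m k"
    using first_cols_isometry[OF onU] first_cols_isometry[OF onV] kr len by (auto simp: defs)
  have sym: "\<Sigma>\<^sub>k\<^sup>T = \<Sigma>\<^sub>k" by (auto simp: defs first_diag_def mat_diag_def)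
  have Ak: "A\<^sub>k = U\<^sub>k * \<Sigma>\<^sub>k * V\<^sub>k\<^sup>T" by (simp add: defs truncated_svd_def)
  have Akc: "A\<^sub>k \<in> carrier_mat m n" using Ak U S V by simp
  have Ahc: "A_hat \<in> carrier_mat m n" using A Akc assms(12) by auto
  have AhT: "A_hat\<^sup>T = A\<^sup>T - A\<^sub>k\<^sup>T"
    using A Akc assms(12) by (simp add: transpose_minus)
  let ?M = "A\<^sub>k\<^sup>T * A\<^sub>k + lam \<cdot>\<^sub>m 1\<^sub>m n"
  let ?w = "A_hat\<^sup>T *\<^sub>v b"
  have w: "?w \<in> carrier_vec n" using Ahc b by simp
  have "\<Sigma>\<^sub>k ^\<^sub>m 2 = \<Sigma>\<^sub>k * \<Sigma>\<^sub>k" using S by (simp add: numeral_2_eq_2)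
  then have first: "x3_tilde = x1_tilde"
    using regularized_solution_factored[OF U S V UU VV sym Ak lam b] assms(13,15) by simp

  have "A_hat = rank_one_sum m n \<sigma> us vs {k..<r}"
    using residual_eq_tail_sum[OF svd kr] defs by simp
  then have AhV: "A_hat * V\<^sub>k = 0\<^sub>m m k"
    using rank_one_sum_annihilates_first_cols[OF onV] kr len by (simp add: defs(2))
  \<comment> \<open>Transposing \<open>A_hat * V\<^sub>k = 0\<close> puts \<open>?w\<close> in the kernel of \<open>V\<^sub>k\<^sup>T\<close>, hence of \<open>A\<^sub>k\<close>.\<close>
  have "V\<^sub>k\<^sup>T *\<^sub>v ?w = (V\<^sub>k\<^sup>T * A_hat\<^sup>T) *\<^sub>v b"
    by (rule assoc_mult_mat_vec[symmetric, of _ k n _ m]) (use V Ahc b in auto)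
  also have "V\<^sub>k\<^sup>T * A_hat\<^sup>T = 0\<^sub>m k m"
    using transpose_mult[OF Ahc V] AhV by simp
  finally have Vw: "V\<^sub>k\<^sup>T *\<^sub>v ?w = 0\<^sub>v k" using b by auto
  have "A\<^sub>k *\<^sub>v ?w = (U\<^sub>k * \<Sigma>\<^sub>k) *\<^sub>v (V\<^sub>k\<^sup>T *\<^sub>v ?w)"
    unfolding Ak by (rule assoc_mult_mat_vec[of _ m k _ n]) (use U S V w in auto)
  also have "\<dots> = 0\<^sub>v m" unfolding Vw using U S by (auto simp del: assoc_mult_mat_vec)
  finally have ker: "A\<^sub>k *\<^sub>v ?w = 0\<^sub>v m" .

  have M: "?M \<in> carrier_mat n n" using Akc by simp
  have Minv: "mat_inv ?M \<in> carrier_mat n n"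
    by (rule mat_inv_correct(3)[OF M det_regularized_gram[OF Akc lam]])
  have "?w = A\<^sup>T *\<^sub>v b - A\<^sub>k\<^sup>T *\<^sub>v b"
    unfolding AhT by (rule minus_mult_distrib_mat_vec[of _ n m]) (use A Akc b in auto)
  then have "mat_inv ?M *\<^sub>v ?w = x1_hat - x1_tilde"
    unfolding assms(13,14)
    using mult_minus_distrib_mat_vec[OF Minv, of "A\<^sup>T *\<^sub>v b" "A\<^sub>k\<^sup>T *\<^sub>v b"] A Akc b by simp
  then have "x1_hat - x1_tilde = inverse lam \<cdot>\<^sub>v ?w"
    using regularized_gram_inv_on_kernel[OF Akc lam w ker] by simp
  then show ?thesis using first AhT by simp
qed

end
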